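(* Let $\kappa=\frac4{27}$ and let $e_n(x)$ be the polynomials of the context. For each parameter tuple $(a,b,c,d)$ below and every integer $n\ge0$, the type I multiple orthogonal polynomials $A^{(n+2)}_1,A^{(n+2)}_2$ (defined in the context) are given by (with $e_k=e_k(x)$): $(\frac13,\frac23,\frac12,1)$: $A_1^{(n+2)}=(\frac{729}4-\frac{6561x}{32})e_n+\frac{135}4e_{n+1}+e_{n+2}$, $A_2^{(n+2)}=-\frac{729}8e_n-\frac{27}2e_{n+1}$; $(\frac23,\frac13,\frac12,1)$: $A_1^{(n+2)}=(\frac{729}{16}-\frac{6561x}{32})e_n+\frac{27}2e_{n+1}+e_{n+2}$, $A_2^{(n+2)}=\frac{729}{16}e_n+\frac{27}4e_{n+1}$; $(\frac23,\frac43,1,\frac32)$: $A_1^{(n+2)}=-\frac{3645}{16}e_n+\frac{135}4e_{n+1}+e_{n+2}$, $A_2^{(n+2)}=\frac{729}4e_n-\frac{27}2e_{n+1}$; $(\frac43,\frac23,1,\frac32)$: $A_1^{(n+2)}=\frac{729}{16}e_n+\frac{27}2e_{n+1}+e_{n+2}$, $A_2^{(n+2)}=-\frac{729}8e_n+\frac{27}4e_{n+1}$; $(\frac43,\frac53,\frac32,2)$: $A_1^{(n+2)}=-\frac{729}8e_n+54e_{n+1}+e_{n+2}$, $A_2^{(n+2)}=-\frac{135}4e_{n+1}$; $(\frac53,\frac43,\frac32,2)$: $A_1^{(n+2)}=-\frac{729}8e_n-\frac{27}4e_{n+1}+e_{n+2}$, $A_2^{(n+2)}=27e_{n+1}$;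 $(\frac13,\frac23,1,\frac32)$: $A_1^{(n+2)}=-\frac{729}8e_n-\frac{27}4e_{n+1}+e_{n+2}$, $A_2^{(n+2)}=\frac{729}4e_n+27e_{n+1}$; $(\frac23,\frac13,1,\frac32)$: $A_1^{(n+2)}=\frac{729}{16}e_n+\frac{27}2e_{n+1}+e_{n+2}$, $A_2^{(n+2)}=\frac{729}{16}e_n+\frac{27}4e_{n+1}$; $(\frac23,\frac43,\frac32,2)$: $A_1^{(n+2)}=\frac{729}{16}e_n-\frac{189}4e_{n+1}+e_{n+2}$, $A_2^{(n+2)}=\frac{135}2e_{n+1}$; $(\frac43,\frac23,\frac32,2)$: $A_1^{(n+2)}=\frac{729}{16}e_n+\frac{27}2e_{n+1}+e_{n+2}$, $A_2^{(n+2)}=\frac{27}4e_{n+1}$; $(\frac43,\frac53,2,\frac52)$: $A_1^{(n+2)}=-\frac{27}2e_{n+1}+e_{n+2}$, $A_2^{(n+2)}=\frac{135}4e_{n+1}$; $(\frac53,\frac43,2,\frac52)$: $A_1^{(n+2)}=\frac{27}4e_{n+1}+e_{n+2}$, $A_2^{(n+2)}=\frac{27}2e_{n+1}$.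
   Context: The polynomials $e_n(x)$ are the coefficients of the formal power series $\frac{1}{(1+t/\kappa)^3-x\,t^2/\kappa^3}=\sum_{n\ge0}e_n(x)t^n$. For parameters $(a,b,c,d)$ put $\delta=c+d-a-b$ (all listed tuples satisfy $a,b,\delta>0$ and $d-a,d-b,c+1-a,c-b\notin\{0,-1,-2,\dots\}$). ${}_2F_1$ is the Gauss hypergeometric function. On $(0,1)$: $w_1(x)={}_2F_1(c-b,d-b;\delta;1-x)$, $w_2(x)=\frac cb{}_2F_1(c-b,d-b-1;\delta;1-x)$, $d\mu(x)=\frac{\Gamma(c)\Gamma(d)}{\Gamma(a)\Gamma(b)\Gamma(\delta)}x^{a-1}(1-x)^{\delta-1}dx$. For $N\ge0$, $A_1^{(N)},A_2^{(N)}$ are the unique polynomials with $\deg A_1^{(N)}\le\lfloor N/2\rfloor$, $\deg A_2^{(N)}\le\lfloor(N-1)/2\rfloor$ ($A_2^{(0)}=0$) such that $q^{(N)}=A_1^{(N)}w_1+A_2^{(N)}w_2$ satisfies $\int_0^1x^kq^{(N)}d\mu=0$ for $0\le k\le N-1$ and $\int_0^1x^Nq^{(N)}d\mu=1$. *)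

theory Defs
  imports "HOL-Analysis.Analysis" "HOL-Computational_Algebra.Polynomial"
          "HOL-Computational_Algebra.Formal_Power_Series"
begin

definition kappa :: real where "kappa = 4/27"

definition e_gf :: "real \<Rightarrow> real fps" where
  "e_gf x = inverse ((1 + fps_const (1/kappa) * fps_X) ^ 3
                     - fps_const (x / kappa ^ 3) * fps_X ^ 2)"

definition e :: "nat \<Rightarrow> real \<Rightarrow> real" where
  "e n x = fps_nth (e_gf x) n"

definition hyp2F1 :: "real \<Rightarrow> real \<Rightarrow> real \<Rightarrow> real \<Rightarrow> real" where
  "hyp2F1 a b c z = (\<Sum>k. pochhammer a k * pochhammer b k / (pochhammer c k * fact k) * z ^ k)"

definition delta :: "real \<Rightarrow> real \<Rightarrow> real \<Rightarrow> real \<Rightarrow> real" where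
  "delta a b c d = c + d - a - b"

definition w1 :: "real \<Rightarrow> real \<Rightarrow> real \<Rightarrow> real \<Rightarrow> real \<Rightarrow> real" where
  "w1 a b c d x = hyp2F1 (c - b) (d - b) (delta a b c d) (1 - x)"

definition w2 :: "real \<Rightarrow> real \<Rightarrow> real \<Rightarrow> real \<Rightarrow> real \<Rightarrow> real" where
  "w2 a b c d x = c / b * hyp2F1 (c - b) (d - b - 1) (delta a b c d) (1 - x)"

definition mu_dens :: "real \<Rightarrow> real \<Rightarrow> real \<Rightarrow> real \<Rightarrow> real \<Rightarrow> real" where
  "mu_dens a b c d x =
     Gamma c * Gamma d / (Gamma a * Gamma b * Gamma (delta a b c d))
     * x powr (a - 1) * (1 - x) powr (delta a b c d - 1)"

definition qN :: "real \<Rightarrow> real \<Rightarrow> real \<Rightarrow> real \<Rightarrow> real poly \<Rightarrow> real poly \<Rightarrow> real \<Rightarrow> real" where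
  "qN a b c d A1 A2 x = poly A1 x * w1 a b c d x + poly A2 x * w2 a b c d x"

definition typeI_cond :: "real \<Rightarrow> real \<Rightarrow> real \<Rightarrow> real \<Rightarrow> nat \<Rightarrow> real poly \<Rightarrow> real poly \<Rightarrow> bool" where
  "typeI_cond a b c d N A1 A2 \<longleftrightarrow>
     degree A1 \<le> N div 2 \<and>
     (if N = 0 then A2 = 0 else degree A2 \<le> (N - 1) div 2) \<and>
     (\<forall>k\<le>N. set_integrable lborel {0<..<1::real}
               (\<lambda>x. x ^ k * qN a b c d A1 A2 x * mu_dens a b c d x)) \<and>
     (\<forall>k<N. (LINT x:{0<..<1}|lborel. x ^ k * qN a b c d A1 A2 x * mu_dens a b c d x) = 0) \<and>
     (LINT x:{0<..<1}|lborel. x ^ N * qN a b c d A1 A2 x * mu_dens a b c d x) = 1"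

definition typeI :: "real \<Rightarrow> real \<Rightarrow> real \<Rightarrow> real \<Rightarrow> nat \<Rightarrow> real poly \<times> real poly" where
  "typeI a b c d N = (THE p. typeI_cond a b c d N (fst p) (snd p))"

definition A1 :: "real \<Rightarrow> real \<Rightarrow> real \<Rightarrow> real \<Rightarrow> nat \<Rightarrow> real poly" where
  "A1 a b c d N = fst (typeI a b c d N)"

definition A2 :: "real \<Rightarrow> real \<Rightarrow> real \<Rightarrow> real \<Rightarrow> nat \<Rightarrow> real poly" where
  "A2 a b c d N = snd (typeI a b c d N)"

end

(* Gauss' summation theorem and termwise integration give the moments
     m1 k = (a)_k (b)_k / ((c)_k (d)_k)  and  m2 k = m1 k * c (b+k) / (b (c+k))
   of w1 and w2, which turns the defining conditions of A1, A2 into a linear system.  Since the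
   denominator of the generating function is (1 + t/kappa)^3 - x t^2 / kappa^3, the proposed linear
   forms q_N satisfy
     kappa^3 q_(N+3) = x q_(N+1) - 3 kappa^2 q_(N+2) - 3 kappa q_(N+1) - q_N.
   The coefficient of X^(k-N) in (1 + kappa X)^(3k) phi(X) satisfies the same recurrence, which is
   the binomial expansion of (1 + kappa X)^3.  For each of the parameter tuples,
   phi(X) = (1 + kappa X)^alpha (1 - 2 epsilon kappa X) with alpha in {0,1,2} and epsilon in {0,1}
   matches the initial forms N = 0, 1, 2, so this coefficient is the k-th moment of q_N; it is 0
   for k < N and 1 for k = N.  Uniqueness follows because q_0, ..., q_N have nonvanishing leading
   coefficients, hence span all admissible pairs, and have a unitriangular moment matrix. *)
theory Submission
  imports Defs "HOL-Real_Asymp.Real_Asymp"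
begin

section \<open>Gauss' summation theorem\<close>

definition hyp_coeff :: "real \<Rightarrow> real \<Rightarrow> real \<Rightarrow> nat \<Rightarrow> real" where
  "hyp_coeff p q c j = pochhammer p j * pochhammer q j / (pochhammer c j * fact j)"

lemma hyp2F1_conv_hyp_coeff: "hyp2F1 p q c z = (\<Sum>j. hyp_coeff p q c j * z ^ j)"
  by (simp add: hyp2F1_def hyp_coeff_def)

lemma hyp_coeff_0 [simp]: "hyp_coeff p q c 0 = 1"
  by (simp add: hyp_coeff_def)

lemma hyp_coeff_Suc:
  "hyp_coeff p q c (Suc j) = hyp_coeff p q c j * ((p + j) * (q + j) / ((c + j) * Suc j))"
  by (simp add: hyp_coeff_def pochhammer_Suc field_simps)

text \<open>Three Gamma limit sequences are multiplied; their powers of n combine to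
  \<open>n powr (c - p - q)\<close>. The factor \<open>Suc n\<close> turns
  \<open>fact (Suc n)\<close> into the \<open>fact n\<close> left over from them.\<close>

lemma hyp_coeff_asymp:
  "(\<lambda>n. hyp_coeff p q c (Suc n) * real (Suc n) * real n powr (c - p - q))
     \<longlonglongrightarrow> rGamma p * rGamma q * Gamma c"
proof -
  have "(\<lambda>n. rGamma_series p n * rGamma_series q n * Gamma_series c n)
          \<longlonglongrightarrow> rGamma p * rGamma q * Gamma c"
    by (intro tendsto_intros)
  moreover have "eventually (\<lambda>n. rGamma_series p n * rGamma_series q n * Gamma_series c n =
      hyp_coeff p q c (Suc n) * real (Suc n) * real n powr (c - p - q)) sequentially"
    using eventually_gt_at_top[of 0]
  proof eventually_elim
    case (elim n)
    have "exp ((c - p - q) * ln (real n)) =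
            exp (c * ln (real n)) / (exp (p * ln (real n)) * exp (q * ln (real n)))"
      by (simp add: algebra_simps flip: exp_add exp_diff)
    then show ?case using elim
      by (simp add: rGamma_series_def Gamma_series_def hyp_coeff_def powr_def mult_ac del: of_nat_Suc)
  qed
  ultimately show ?thesis
    by (rule Lim_transform_eventually)
qed

text \<open>By the asymptotics the coefficients are of order j^(p+q-c-1), so comparison with a
  convergent power series in 1/j applies. The null sequence is the boundary term of the telescoping
  sum in \<open>hyp2F1_1_contiguous\<close>.\<close>

lemma
  assumes "c - p - q > 0"
  shows summable_abs_hyp_coeff: "summable (\<lambda>j. \<bar>hyp_coeff p q c j\<bar>)"
    and hyp_coeff_times_index_tendsto_0: "(\<lambda>j. j * hyp_coeff p q c j) \<longlonglongrightarrow> 0"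
proof -
  define s where "s = c - p - q"
  have s: "s > 0" using assms by (simp add: s_def)
  let ?X = "\<lambda>n. hyp_coeff p q c (Suc n) * real (Suc n) * real n powr s"
  have X: "?X \<longlonglongrightarrow> rGamma p * rGamma q * Gamma c"
    unfolding s_def by (rule hyp_coeff_asymp)
  then have "Bseq ?X"
    by (intro convergent_imp_Bseq convergentI)
  then obtain K where K: "K > 0" "\<And>n. norm (?X n) \<le> K"
    by (auto elim: BseqE)
  have "summable (\<lambda>n. \<bar>hyp_coeff p q c (Suc n)\<bar>)"
  proof (rule summable_comparison_test_ev)
    show "summable (\<lambda>n. K * real n powr (- 1 - s))"
      using s by (intro summable_mult) (simp add: summable_real_powr_iff)
    show "eventually (\<lambda>n. norm \<bar>hyp_coeff p q c (Suc n)\<bar> \<le> K * real n powr (- 1 - s)) sequentially"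
      using eventually_gt_at_top[of 0]
    proof eventually_elim
      case (elim n)
      have "\<bar>hyp_coeff p q c (Suc n)\<bar> * (real n * real n powr s)
              \<le> \<bar>hyp_coeff p q c (Suc n)\<bar> * (real (Suc n) * real n powr s)"
        by (intro mult_left_mono mult_right_mono) auto
      also have "\<dots> = norm (?X n)"
        by (simp add: abs_mult)
      also have "\<dots> \<le> K"
        by (rule K)
      finally show ?case using elim
        by (simp add: powr_diff powr_minus field_simps)
    qed
  qed
  then show "summable (\<lambda>j. \<bar>hyp_coeff p q c j\<bar>)"
    by (subst (asm) summable_Suc_iff)
  have "(\<lambda>n. real n powr (- s)) \<longlonglongrightarrow> 0"
    using s by (intro tendsto_neg_powr filterlim_real_sequentially) auto
  then have "(\<lambda>n. ?X n * real n powr (- s)) \<longlonglongrightarrow> (rGamma p * rGamma q * Gamma c) * 0"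
    by (intro tendsto_mult X)
  moreover have "eventually (\<lambda>n. ?X n * real n powr (- s) = Suc n * hyp_coeff p q c (Suc n)) sequentially"
    using eventually_gt_at_top[of 0]
    by eventually_elim (simp add: powr_minus field_simps)
  ultimately have "(\<lambda>n. Suc n * hyp_coeff p q c (Suc n)) \<longlonglongrightarrow> 0"
    by (simp add: Lim_transform_eventually)
  then show "(\<lambda>j. j * hyp_coeff p q c j) \<longlonglongrightarrow> 0"
    by (rule LIMSEQ_imp_Suc)
qed

lemma hyp_coeff_shift:
  assumes "c > 0"
  shows "hyp_coeff p q (c + 1) j = hyp_coeff p q c j * (c / (c + j))"
proof -
  have "pochhammer c j * (c + j) = c * pochhammer (c + 1) j"
    by (metis pochhammer_Suc pochhammer_rec)
  moreover have "pochhammer c j > 0" "pochhammer (c + 1) j > 0"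
    using assms by (auto intro: pochhammer_pos)
  moreover have "c + real j > 0"
    using assms by simp
  ultimately show ?thesis
    using assms by (simp add: hyp_coeff_def divide_simps)
qed

text \<open>Termwise, the difference of the two sides is the forward difference of
  \<open>- c * (j * ?t j)\<close>, which starts at 0 and tends to 0, so it sums to 0.\<close>

lemma hyp2F1_1_contiguous:
  assumes "c > 0" "c - p - q > 0"
  shows "c * (c - p - q) * hyp2F1 p q c 1 = (c - p) * (c - q) * hyp2F1 p q (c + 1) 1"
proof -
  let ?t = "hyp_coeff p q c" and ?u = "hyp_coeff p q (c + 1)"
  have "summable ?t" "summable ?u"
    using assms by (auto intro!: summable_rabs_cancel summable_abs_hyp_coeff)
  then have lim: "(\<lambda>j. c * (c - p - q) * ?t j - (c - p) * (c - q) * ?u j) sums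
          (c * (c - p - q) * (\<Sum>j. ?t j) - (c - p) * (c - q) * (\<Sum>j. ?u j))"
    by (intro sums_diff sums_mult summable_sums)
  have "(\<lambda>j. - c * (j * ?t j)) \<longlonglongrightarrow> - c * 0"
    using assms by (intro tendsto_mult tendsto_const hyp_coeff_times_index_tendsto_0)
  then have "(\<lambda>j. - c * (j * ?t j)) \<longlonglongrightarrow> 0"
    by simp
  from telescope_sums[OF this]
  have "(\<lambda>j. - c * (Suc j * ?t (Suc j)) - (- c * (j * ?t j))) sums 0"
    by simp
  moreover have "- c * (Suc j * ?t (Suc j)) - (- c * (j * ?t j)) =
      c * (c - p - q) * ?t j - (c - p) * (c - q) * ?u j" for j
  proof -
    have "c + real j > 0"
      using assms by simp
    \<comment> \<open>The telescoping identity with the common factor \<open>?t j\<close>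
      removed.\<close>
    then have "- c * ((p + j) * (q + j) / (c + j)) + c * j =
        c * (c - p - q) - (c - p) * (c - q) * (c / (c + j))"
      by (simp add: divide_simps) algebra
    moreover have "Suc j * ?t (Suc j) = ?t j * ((p + j) * (q + j) / (c + j))"
      by (simp add: hyp_coeff_Suc divide_simps del: of_nat_Suc)
    ultimately show ?thesis
      using \<open>c > 0\<close> by (simp add: hyp_coeff_shift del: of_nat_Suc) algebra
  qed
  ultimately have "c * (c - p - q) * (\<Sum>j. ?t j) - (c - p) * (c - q) * (\<Sum>j. ?u j) = 0"
    using lim sums_unique2 by fastforce
  then show ?thesis
    by (simp add: hyp2F1_conv_hyp_coeff)
qed

lemma hyp2F1_1_shift:
  assumes "c > 0" "c - p - q > 0"
  shows "pochhammer c n * pochhammer (c - p - q) n * hyp2F1 p q c 1 =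
         pochhammer (c - p) n * pochhammer (c - q) n * hyp2F1 p q (c + n) 1"
proof (induction n)
  case (Suc n)
  have "(c + n) * (c + n - p - q) * hyp2F1 p q (c + n) 1 =
          (c + n - p) * (c + n - q) * hyp2F1 p q (c + n + 1) 1"
    using assms by (intro hyp2F1_1_contiguous) auto
  moreover have "c + real (Suc n) = c + n + 1"
    by simp
  ultimately show ?case
    using Suc.IH unfolding pochhammer_Suc by (simp only: ) algebra
qed simp

text \<open>Tannery's theorem: only the term j = 0 survives in the limit, and the coefficients at n
  = 0 dominate because raising c enlarges the Pochhammer symbol in the denominator.\<close>

lemma hyp2F1_1_tendsto_1:
  assumes "c > 0" "c - p - q > 0"
  shows "(\<lambda>n. hyp2F1 p q (c + real n) 1) \<longlonglongrightarrow> 1"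
proof -
  let ?b = "\<lambda>j. if j = 0 then 1 else 0 :: real"
  have 1: "(\<lambda>n. hyp_coeff p q (c + real n) j) \<longlonglongrightarrow> ?b j" for j
  proof (cases j)
    case (Suc i)
    have "filterlim (\<lambda>n. pochhammer (c + real n) j) at_top sequentially"
    proof (rule filterlim_at_top_mono)
      show "filterlim (\<lambda>n. c + real n) at_top sequentially"
        by (intro filterlim_tendsto_add_at_top[OF tendsto_const] filterlim_real_sequentially)
      \<comment> \<open>As j is positive, the first factor \<open>c + real n\<close> can be split
        off; the remaining factors are at least 1.\<close>
      have "c + real n \<le> pochhammer (c + real n) j" if "n \<ge> 1" for n
      proof -
        have "1 \<le> pochhammer (c + real n + 1) i"
          using assms that unfolding pochhammer_prod by (intro prod_ge_1) auto
        then show ?thesis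
          using assms unfolding Suc pochhammer_rec by simp
      qed
      then show "eventually (\<lambda>n. c + real n \<le> pochhammer (c + real n) j) sequentially"
        by (intro eventually_mono[OF eventually_ge_at_top[of 1]])
    qed
    then have "filterlim (\<lambda>n. pochhammer (c + real n) j * fact j) at_top sequentially"
      by (intro filterlim_at_top_mult_tendsto_pos[OF tendsto_const]) auto
    then show ?thesis
      unfolding hyp_coeff_def using Suc
      by (auto intro!: tendsto_divide_0[OF tendsto_const] filterlim_at_top_imp_at_infinity)
  qed auto
  have 2: "\<bar>hyp_coeff p q (c + real n) j\<bar> \<le> \<bar>hyp_coeff p q c j\<bar>" for n j
  proof -
    have "pochhammer c j \<le> pochhammer (c + real n) j"
      using assms unfolding pochhammer_prod by (intro prod_mono) auto
    moreover have "pochhammer c j > 0"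
      using assms by (intro pochhammer_pos)
    ultimately show ?thesis
      by (auto simp: hyp_coeff_def abs_mult intro!: divide_left_mono mult_right_mono)
  qed
  have "eventually (\<lambda>(j, n). norm (hyp_coeff p q (c + real n) j) \<le> \<bar>hyp_coeff p q c j\<bar>)
      (at_top \<times>\<^sub>F sequentially)"
    using 2 by (intro always_eventually) auto
  from tannerys_theorem[OF 1 this]
  have "(\<lambda>n. \<Sum>j. hyp_coeff p q (c + real n) j) \<longlonglongrightarrow> (\<Sum>j. ?b j)"
    using assms by (auto simp: summable_abs_hyp_coeff)
  moreover have "(\<Sum>j. ?b j) = 1"
    using suminf_finite[of "{0}" ?b] by auto
  ultimately show ?thesis
    by (simp add: hyp2F1_conv_hyp_coeff)
qed

text \<open>Compare the shift formula with the limit definition of the reciprocal Gamma function.\<close>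
theorem hyp2F1_1_Gauss:
  assumes "c > 0" "c - p - q > 0"
  shows "hyp2F1 p q c 1 * rGamma c * rGamma (c - p - q) = rGamma (c - p) * rGamma (c - q)"
proof (rule LIMSEQ_unique)
  show "(\<lambda>n. hyp2F1 p q c 1 * rGamma_series c n * rGamma_series (c - p - q) n)
          \<longlonglongrightarrow> hyp2F1 p q c 1 * rGamma c * rGamma (c - p - q)"
    by (intro tendsto_intros)
  \<comment> \<open>The offset matches the n + 1 factors of the Pochhammer symbol in
    \<open>rGamma_series\<close>.\<close>
  have "(\<lambda>n. hyp2F1 p q (c + real (n + 1)) 1) \<longlonglongrightarrow> 1"
    using hyp2F1_1_tendsto_1[OF assms] by (rule LIMSEQ_ignore_initial_segment)
  then have "(\<lambda>n. rGamma_series (c - p) n * rGamma_series (c - q) n * hyp2F1 p q (c + real (n + 1)) 1)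
        \<longlonglongrightarrow> rGamma (c - p) * rGamma (c - q) * 1"
    by (intro tendsto_intros)
  moreover have "rGamma_series (c - p) n * rGamma_series (c - q) n * hyp2F1 p q (c + real (n + 1)) 1 =
      hyp2F1 p q c 1 * rGamma_series c n * rGamma_series (c - p - q) n" for n
  proof -
    \<comment> \<open>The powers of n on both sides agree since c + (c - p - q) = (c - p) + (c -
      q).\<close>
    have "exp (c * ln (real n)) * exp ((c - p - q) * ln (real n)) =
          exp ((c - p) * ln (real n)) * exp ((c - q) * ln (real n))"
      by (simp add: algebra_simps flip: exp_add)
    with hyp2F1_1_shift[OF assms, of "n + 1"] show ?thesis
      unfolding rGamma_series_def times_divide_eq_left times_divide_eq_right
        divide_divide_eq_left of_real_eq_id id_apply
      by (simp add: mult_ac)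
  qed
  ultimately show "(\<lambda>n. hyp2F1 p q c 1 * rGamma_series c n * rGamma_series (c - p - q) n)
          \<longlonglongrightarrow> rGamma (c - p) * rGamma (c - q)"
    by simp
qed

section \<open>Moments of the weights\<close>

text \<open>Ratio test: quotients of successive terms tend to z in absolute value, hence eventually
  stay below some r < 1.\<close>

lemma hyp_coeff_power_summable:
  assumes "c > 0" "\<bar>z\<bar> < 1"
  shows "summable (\<lambda>j. \<bar>hyp_coeff p q c j * z ^ j\<bar>)"
proof -
  obtain r where r: "\<bar>z\<bar> < r" "r < 1"
    using assms dense by blast
  let ?f = "\<lambda>j. \<bar>(p + real j) * (q + real j) / ((c + real j) * (1 + real j)) * z\<bar>"
  have "(\<lambda>j. (p + real j) * (q + real j) / ((c + real j) * (1 + real j))) \<longlonglongrightarrow> 1"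
    by real_asymp
  then have "?f \<longlonglongrightarrow> \<bar>1 * z\<bar>"
    by (intro tendsto_intros)
  then have "eventually (\<lambda>j. ?f j < r) sequentially"
    using r by (intro order_tendstoD) auto
  then obtain N where N: "\<And>j. j \<ge> N \<Longrightarrow> ?f j < r"
    by (auto simp: eventually_sequentially)
  show ?thesis
  proof (rule summable_ratio_test[of r N])
    fix j assume "j \<ge> N"
    have "hyp_coeff p q c (Suc j) * z ^ Suc j =
        (p + real j) * (q + real j) / ((c + real j) * (1 + real j)) * z * (hyp_coeff p q c j * z ^ j)"
      by (simp add: hyp_coeff_Suc)
    then have "norm \<bar>hyp_coeff p q c (Suc j) * z ^ Suc j\<bar> = ?f j * \<bar>hyp_coeff p q c j * z ^ j\<bar>"
      by (simp only: abs_mult real_norm_def abs_abs)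
    also have "\<dots> \<le> r * \<bar>hyp_coeff p q c j * z ^ j\<bar>"
      using N[OF \<open>j \<ge> N\<close>] by (intro mult_right_mono) auto
    finally show "norm \<bar>hyp_coeff p q c (Suc j) * z ^ Suc j\<bar> \<le> r * norm \<bar>hyp_coeff p q c j * z ^ j\<bar>"
      by simp
  qed (use r in auto)
qed

text \<open>The gauge integral known on the closed interval is transferred: nonnegativity of the
  integrand makes it absolute, and Borel measurability carries it from \<open>lebesgue\<close> to
  \<open>lborel\<close>.\<close>

lemma
  fixes s t :: real
  assumes "s > 0" "t > 0"
  shows set_integrable_Beta:
      "set_integrable lborel {0<..<1} (\<lambda>x. x powr (s - 1) * (1 - x) powr (t - 1))"
    and set_integral_Beta:
      "(LINT x:{0<..<1}|lborel. x powr (s - 1) * (1 - x) powr (t - 1)) = Beta s t"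
proof -
  let ?f = "\<lambda>x::real. x powr (s - 1) * (1 - x) powr (t - 1)"
  have I: "(?f has_integral Beta s t) {0<..<1}"
    using has_integral_Beta_real[OF assms] by (simp add: has_integral_Icc_iff_Ioo)
  have "?f absolutely_integrable_on {0<..<1}"
    using I by (intro nonnegative_absolutely_integrable_1) auto
  then have L: "set_integrable lebesgue {0<..<1} ?f" .
  have M: "(\<lambda>x. indicator {0<..<1} x *\<^sub>R ?f x) \<in> borel_measurable lborel"
    by measurable
  show "set_integrable lborel {0<..<1} ?f"
    using L M unfolding set_integrable_def by (simp add: integrable_completion)
  have "(LINT x:{0<..<1}|lborel. ?f x) = (LINT x:{0<..<1}|lebesgue. ?f x)"
    using M unfolding set_lebesgue_integral_def by (simp add: integral_completion)
  also have "\<dots> = integral {0<..<1} ?f"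
    by (rule set_lebesgue_integral_eq_integral(2)[OF L])
  also have "\<dots> = Beta s t"
    using I by (rule integral_unique)
  finally show "(LINT x:{0<..<1}|lborel. ?f x) = Beta s t" .
qed

lemma Beta_plus_of_nat:
  fixes s t :: real
  assumes "s > 0" "t > 0"
  shows "Beta s (t + real j) = Beta s t * (pochhammer t j / pochhammer (s + t) j)"
proof -
  have "Gamma (t + real j) = pochhammer t j * Gamma t"
    using assms by (subst pochhammer_Gamma) (auto simp: Gamma_eq_zero_iff)
  moreover have "Gamma (s + t + real j) = pochhammer (s + t) j * Gamma (s + t)"
    using assms by (subst pochhammer_Gamma) (auto simp: Gamma_eq_zero_iff)
  ultimately show ?thesis
    by (simp add: Beta_def add.assoc mult_ac)
qed

text \<open>Expanding around \<open>x = 1\<close> and integrating termwise turns the Mellin transform into a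
  hypergeometric series at \<open>1\<close>.\<close>
theorem
  fixes p q s t :: real
  assumes "s > 0" "t > 0" "s + t - p - q > 0"
  defines "f \<equiv> \<lambda>x. x powr (s - 1) * (1 - x) powr (t - 1) * hyp2F1 p q t (1 - x)"
  shows set_integrable_Mellin_hyp2F1: "set_integrable lborel {0<..<1} f"
    and set_integral_Mellin_hyp2F1: "(LINT x:{0<..<1}|lborel. f x) =
      Gamma s * Gamma t * Gamma (s + t - p - q) * rGamma (s + t - p) * rGamma (s + t - q)"
proof -
  define g where "g j x = indicator {0<..<1} x *\<^sub>R
      (hyp_coeff p q t j * (x powr (s - 1) * (1 - x) powr (t + real j - 1)))" for j and x :: real
  have gint: "integrable lborel (\<lambda>x. indicator {0<..<1} x *\<^sub>R
      (C * (x powr (s - 1) * (1 - x) powr (t + real j - 1))))" for j C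
    using set_integrable_Beta[of s "t + real j"] assms
    by (simp add: set_integrable_def mult.left_commute[of _ C])
  have gval: "(LINT x|lborel. indicator {0<..<1} x *\<^sub>R
      (C * (x powr (s - 1) * (1 - x) powr (t + real j - 1)))) = C * Beta s (t + real j)" for j C
    using set_integral_Beta[of s "t + real j"] assms
    by (simp add: set_lebesgue_integral_def mult.left_commute[of _ C])
  \<comment> \<open>The factor \<open>pochhammer t j\<close> cancels, so integration raises the
    lower parameter from t to s + t.\<close>
  have Beta: "hyp_coeff p q t j * Beta s (t + real j) = Beta s t * hyp_coeff p q (s + t) j" for j
  proof -
    have "pochhammer t j > 0"
      using assms by (intro pochhammer_pos)
    then show ?thesis
      using assms by (simp add: Beta_plus_of_nat hyp_coeff_def mult_ac)
  qed
  have Bpos: "Beta s r > 0" if "r > 0" for r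
    using that \<open>s > 0\<close> by (simp add: Beta_def)
  have norm_g: "norm (g j x) = indicator {0<..<1} x *\<^sub>R
      (\<bar>hyp_coeff p q t j\<bar> * (x powr (s - 1) * (1 - x) powr (t + real j - 1)))" for j x
    by (simp add: g_def abs_mult indicator_def)
  have sum: "summable (\<lambda>j. \<bar>hyp_coeff p q (s + t) j\<bar>)"
    using assms by (intro summable_abs_hyp_coeff) auto
  \<comment> \<open>Summability of these norms, which rests on \<open>s + t - p - q > 0\<close>,
    justifies exchanging sum and integral.\<close>
  have "(\<integral>x. norm (g j x) \<partial>lborel) = Beta s t * \<bar>hyp_coeff p q (s + t) j\<bar>" for j
  proof -
    have "(\<integral>x. norm (g j x) \<partial>lborel) = \<bar>hyp_coeff p q t j * Beta s (t + real j)\<bar>"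
      unfolding norm_g gval using Bpos[of "t + real j"] assms by (simp add: abs_mult)
    then show ?thesis
      unfolding Beta using Bpos[of t] assms by (simp add: abs_mult)
  qed
  then have sum_norm: "summable (\<lambda>j. \<integral>x. norm (g j x) \<partial>lborel)"
    using sum by simp
  have g_conv: "g j x = indicator {0<..<1} x *\<^sub>R (x powr (s - 1) * (1 - x) powr (t - 1)) *
      (hyp_coeff p q t j * (1 - x) ^ j)" for j x
  proof (cases "x \<in> {0<..<1}")
    case True
    then have "(1 - x) powr (t + real j - 1) = (1 - x) powr (t - 1) * (1 - x) ^ j"
      by (simp add: powr_realpow[symmetric] flip: powr_add) (simp add: algebra_simps)
    then show ?thesis
      by (simp add: g_def)
  qed (auto simp: g_def)
  have summable_pt: "summable (\<lambda>j. norm (g j x))" for x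
  proof (cases "x \<in> {0<..<1}")
    case True
    then have "norm (g j x) = x powr (s - 1) * (1 - x) powr (t - 1) * \<bar>hyp_coeff p q t j * (1 - x) ^ j\<bar>" for j
      by (simp add: g_conv abs_mult)
    moreover have "summable (\<lambda>j. \<bar>hyp_coeff p q t j * (1 - x) ^ j\<bar>)"
      using True \<open>t > 0\<close> by (intro hyp_coeff_power_summable) auto
    ultimately show ?thesis
      by (simp add: summable_mult)
  qed (auto simp: g_def)
  have suminf_g: "(\<Sum>j. g j x) = indicator {0<..<1} x *\<^sub>R f x" for x
  proof (cases "x \<in> {0<..<1}")
    case True
    then have "summable (\<lambda>j. hyp_coeff p q t j * (1 - x) ^ j)"
      using \<open>t > 0\<close> by (intro summable_rabs_cancel[OF hyp_coeff_power_summable]) auto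
    then show ?thesis
      unfolding g_conv by (subst suminf_mult) (auto simp: f_def hyp2F1_conv_hyp_coeff)
  qed (auto simp: g_def)
  have int: "integrable lborel (g j)" for j
    unfolding g_def by (rule gint)
  have "integrable lborel (\<lambda>x. \<Sum>j. g j x)"
    using summable_pt sum_norm by (intro integrable_suminf int) auto
  then show "set_integrable lborel {0<..<1} f"
    by (simp add: suminf_g set_integrable_def)
  have "(LINT x:{0<..<1}|lborel. f x) = (LINT x|lborel. (\<Sum>j. g j x))"
    by (simp add: suminf_g set_lebesgue_integral_def)
  also have "\<dots> = (\<Sum>j. LINT x|lborel. g j x)"
    using summable_pt sum_norm by (intro integral_suminf int) auto
  also have "\<dots> = (\<Sum>j. Beta s t * hyp_coeff p q (s + t) j)"
    unfolding g_def gval Beta ..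
  also have "\<dots> = Beta s t * hyp2F1 p q (s + t) 1"
    using suminf_mult[OF summable_rabs_cancel[OF sum]] by (simp add: hyp2F1_conv_hyp_coeff)
  \<comment> \<open>A factor \<open>Gamma (s + t - p - q)\<close> and its reciprocal are inserted to
    produce the left side of Gauss' theorem.\<close>
  also have "\<dots> = Gamma s * Gamma t * Gamma (s + t - p - q) *
      (hyp2F1 p q (s + t) 1 * rGamma (s + t) * rGamma (s + t - p - q))"
  proof -
    have "Gamma (s + t - p - q) > 0"
      using assms by simp
    then show ?thesis
      by (simp add: Beta_altdef rGamma_inverse_Gamma)
  qed
  also have "\<dots> = Gamma s * Gamma t * Gamma (s + t - p - q) * rGamma (s + t - p) * rGamma (s + t - q)"
    using assms by (subst hyp2F1_1_Gauss) auto
  finally show "(LINT x:{0<..<1}|lborel. f x) =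
      Gamma s * Gamma t * Gamma (s + t - p - q) * rGamma (s + t - p) * rGamma (s + t - q)" .
qed

lemma
  fixes f :: "'b \<Rightarrow> 'a \<Rightarrow> real"
  assumes "\<And>i. i \<in> I \<Longrightarrow> set_integrable M A (f i)"
  shows set_integrable_sum: "set_integrable M A (\<lambda>x. \<Sum>i\<in>I. f i x)"
    and set_integral_sum: "(LINT x:A|M. (\<Sum>i\<in>I. f i x)) = (\<Sum>i\<in>I. LINT x:A|M. f i x)"
  using assms unfolding set_integrable_def set_lebesgue_integral_def scaleR_sum_right
  by (auto intro: Bochner_Integration.integrable_sum Bochner_Integration.integral_sum)

locale hyp_params =
  fixes a b c d :: real
  assumes pos: "a > 0" "b > 0" "c > 0" "d > 0" and delta_pos: "delta a b c d > 0"
begin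

definition m1 :: "nat \<Rightarrow> real" where
  "m1 k = pochhammer a k * pochhammer b k / (pochhammer c k * pochhammer d k)"

text \<open>Equivalently (a)_k (b+1)_k / ((c+1)_k (d)_k), that is, \<open>m1\<close> with b and c
  raised by one.\<close>

definition m2 :: "nat \<Rightarrow> real" where
  "m2 k = m1 k * (c * (b + k) / (b * (c + k)))"

text \<open>Up to a constant, each integrand is that of the Mellin transform with s = a + k and t =
  \<open>delta a b c d\<close>; the resulting Gamma quotients reduce to Pochhammer symbols.\<close>

lemma
  shows set_integrable_w1:
      "set_integrable lborel {0<..<1} (\<lambda>x. x ^ k * w1 a b c d x * mu_dens a b c d x)"
    and set_integral_w1:
      "(LINT x:{0<..<1}|lborel. x ^ k * w1 a b c d x * mu_dens a b c d x) = m1 k"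
    and set_integrable_w2:
      "set_integrable lborel {0<..<1} (\<lambda>x. x ^ k * w2 a b c d x * mu_dens a b c d x)"
    and set_integral_w2:
      "(LINT x:{0<..<1}|lborel. x ^ k * w2 a b c d x * mu_dens a b c d x) = m2 k"
proof -
  let ?D = "delta a b c d"
  define C where "C = Gamma c * Gamma d / (Gamma a * Gamma b * Gamma ?D)"
  \<comment> \<open>The value r = 0 belongs to \<open>w1\<close> and r = 1 to
    \<open>w2\<close>.\<close>
  define f where "f r x = x powr (a + real k - 1) * (1 - x) powr (?D - 1) *
      hyp2F1 (c - b) (d - b - r) ?D (1 - x)" for r x
  have exps: "a + real k + ?D - (c - b) - (d - b - r) = b + k + r"
      "a + real k + ?D - (c - b) = d + k" "a + real k + ?D - (d - b - r) = c + k + r" for r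
    by (auto simp: delta_def)
  have f: "set_integrable lborel {0<..<1} (f r)"
      "(LINT x:{0<..<1}|lborel. f r x) =
        Gamma (a + k) * Gamma ?D * Gamma (b + k + r) * rGamma (d + k) * rGamma (c + k + r)"
    if "r \<ge> 0" for r
  proof -
    have *: "a + real k > 0" "a + real k + ?D - (c - b) - (d - b - r) > 0"
      using that pos by (simp_all only: exps add_pos_nonneg add_nonneg_pos of_nat_0_le_iff)
    show "set_integrable lborel {0<..<1} (f r)"
      unfolding f_def by (rule set_integrable_Mellin_hyp2F1[OF *(1) delta_pos *(2)])
    show "(LINT x:{0<..<1}|lborel. f r x) =
        Gamma (a + k) * Gamma ?D * Gamma (b + k + r) * rGamma (d + k) * rGamma (c + k + r)"
      unfolding f_def set_integral_Mellin_hyp2F1[OF *(1) delta_pos *(2)] exps(1)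
      unfolding exps(2,3) ..
  qed
  have pw: "x ^ k * x powr (a - 1) = x powr (a + real k - 1)" if "x > 0" for x
  proof -
    have "x ^ k * x powr (a - 1) = x powr (real k + (a - 1))"
      using that by (simp only: powr_realpow powr_add)
    also have "real k + (a - 1) = a + real k - 1"
      by simp
    finally show ?thesis .
  qed
  have w1: "x ^ k * w1 a b c d x * mu_dens a b c d x = C * f 0 x" if "x \<in> {0<..<1}" for x
    using that by (simp add: w1_def mu_dens_def C_def f_def pw[symmetric] mult_ac)
  have w2: "x ^ k * w2 a b c d x * mu_dens a b c d x = C * (c / b) * f 1 x" if "x \<in> {0<..<1}" for x
    using that by (simp add: w2_def mu_dens_def C_def f_def pw[symmetric] mult_ac)
  have lborel: "{0<..<1::real} \<in> sets lborel"
    by simp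
  show "set_integrable lborel {0<..<1} (\<lambda>x. x ^ k * w1 a b c d x * mu_dens a b c d x)"
  proof -
    have "set_integrable lborel {0<..<1} (\<lambda>x. C * f 0 x)"
      by (rule set_integrable_mult_right, rule f) simp
    then show ?thesis
      by (simp only: set_integrable_cong[OF refl refl w1])
  qed
  show "set_integrable lborel {0<..<1} (\<lambda>x. x ^ k * w2 a b c d x * mu_dens a b c d x)"
  proof -
    have "set_integrable lborel {0<..<1} (\<lambda>x. C * (c / b) * f 1 x)"
      by (rule set_integrable_mult_right, rule f) simp
    then show ?thesis
      by (simp only: set_integrable_cong[OF refl refl w2])
  qed
  have Gamma_shift: "Gamma (z + real n) = pochhammer z n * Gamma z" if "z > 0" for z n
    using that by (subst pochhammer_Gamma) (auto simp: Gamma_eq_zero_iff)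
  have nz: "Gamma a \<noteq> 0" "Gamma b \<noteq> 0" "Gamma c \<noteq> 0" "Gamma d \<noteq> 0" "Gamma ?D \<noteq> 0"
      "pochhammer c k \<noteq> 0" "pochhammer d k \<noteq> 0"
    using pos delta_pos by (auto intro!: less_imp_neq[OF Gamma_real_pos, symmetric]
        less_imp_neq[OF pochhammer_pos, symmetric] simp del: Gamma_eq_zero_iff)
  have "(LINT x:{0<..<1}|lborel. x ^ k * w1 a b c d x * mu_dens a b c d x) =
      (LINT x:{0<..<1}|lborel. C * f 0 x)"
    by (intro set_lebesgue_integral_cong lborel allI impI w1)
  also have "\<dots> = C * (LINT x:{0<..<1}|lborel. f 0 x)"
    by (rule set_integral_mult_right)
  also have "\<dots> = m1 k"
    using nz pos by (simp add: f C_def m1_def rGamma_inverse_Gamma Gamma_shift field_simps)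
  finally show "(LINT x:{0<..<1}|lborel. x ^ k * w1 a b c d x * mu_dens a b c d x) = m1 k" .
  have "(LINT x:{0<..<1}|lborel. x ^ k * w2 a b c d x * mu_dens a b c d x) =
      (LINT x:{0<..<1}|lborel. C * (c / b) * f 1 x)"
    by (intro set_lebesgue_integral_cong lborel allI impI w2)
  also have "\<dots> = C * (c / b) * (LINT x:{0<..<1}|lborel. f 1 x)"
    by (rule set_integral_mult_right)
  also have "\<dots> = m2 k"
  proof -
    \<comment> \<open>For r = 1 these arguments are raised by one, which yields the extra factor (b
      + k) / (c + k) of \<open>m2\<close>.\<close>
    have "Gamma (b + k + 1) = (b + k) * (pochhammer b k * Gamma b)"
        "Gamma (c + k + 1) = (c + k) * (pochhammer c k * Gamma c)"
      using Gamma_shift[of b "Suc k"] Gamma_shift[of c "Suc k"] pos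
      by (simp_all add: pochhammer_Suc add_ac)
    moreover have "c + k > 0"
      using pos by simp
    ultimately show ?thesis
      using nz pos by (simp add: f C_def m1_def m2_def rGamma_inverse_Gamma Gamma_shift)
        (simp add: divide_simps)
  qed
  finally show "(LINT x:{0<..<1}|lborel. x ^ k * w2 a b c d x * mu_dens a b c d x) = m2 k" .
qed

definition moment :: "nat \<Rightarrow> real poly \<Rightarrow> real poly \<Rightarrow> real" where
  "moment k P Q = (\<Sum>i\<le>degree P. coeff P i * m1 (k + i)) + (\<Sum>i\<le>degree Q. coeff Q i * m2 (k + i))"

text \<open>Multiplying the monomial of degree i by x^k shifts the moment index to k + i, so the
  integral conditions become linear in the coefficients.\<close>

lemma
  shows set_integrable_qN:
      "set_integrable lborel {0<..<1} (\<lambda>x. x ^ k * qN a b c d P Q x * mu_dens a b c d x)"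
    and set_integral_qN:
      "(LINT x:{0<..<1}|lborel. x ^ k * qN a b c d P Q x * mu_dens a b c d x) = moment k P Q"
proof -
  let ?u = "\<lambda>k x. x ^ k * w1 a b c d x * mu_dens a b c d x"
  let ?v = "\<lambda>k x. x ^ k * w2 a b c d x * mu_dens a b c d x"
  have eq: "x ^ k * qN a b c d P Q x * mu_dens a b c d x =
      (\<Sum>i\<le>degree P. coeff P i * ?u (k + i) x) + (\<Sum>i\<le>degree Q. coeff Q i * ?v (k + i) x)" for x
    by (simp add: qN_def poly_altdef sum_distrib_left sum_distrib_right ring_distribs power_add mult_ac)
  have I: "set_integrable lborel {0<..<1} (\<lambda>x. \<Sum>i\<le>degree P. coeff P i * ?u (k + i) x)"
      "set_integrable lborel {0<..<1} (\<lambda>x. \<Sum>i\<le>degree Q. coeff Q i * ?v (k + i) x)"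
    by (auto intro!: set_integrable_sum set_integrable_mult_right set_integrable_w1 set_integrable_w2)
  show "set_integrable lborel {0<..<1} (\<lambda>x. x ^ k * qN a b c d P Q x * mu_dens a b c d x)"
    unfolding eq by (intro set_integral_add I)
  have "(LINT x:{0<..<1}|lborel. (\<Sum>i\<le>degree P. coeff P i * ?u (k + i) x)) =
      (\<Sum>i\<le>degree P. coeff P i * m1 (k + i))"
    using set_integrable_w1
    by (subst set_integral_sum) (auto simp: set_integral_w1)
  moreover have "(LINT x:{0<..<1}|lborel. (\<Sum>i\<le>degree Q. coeff Q i * ?v (k + i) x)) =
      (\<Sum>i\<le>degree Q. coeff Q i * m2 (k + i))"
    using set_integrable_w2
    by (subst set_integral_sum) (auto simp: set_integral_w2)
  ultimately show "(LINT x:{0<..<1}|lborel. x ^ k * qN a b c d P Q x * mu_dens a b c d x) = moment k P Q"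
    unfolding eq moment_def using I by (subst set_integral_add) auto
qed

end

section \<open>Uniqueness of type I polynomials\<close>

text \<open>The moment functional of the sequence m.\<close>

definition lin_fun :: "(nat \<Rightarrow> real) \<Rightarrow> real poly \<Rightarrow> real" where
  "lin_fun m p = (\<Sum>i\<le>degree p. coeff p i * m i)"

lemma lin_fun_altdef: "degree p \<le> n \<Longrightarrow> lin_fun m p = (\<Sum>i\<le>n. coeff p i * m i)"
  unfolding lin_fun_def by (rule sum.mono_neutral_left) (auto simp: coeff_eq_0)

lemma lin_fun_0 [simp]: "lin_fun m 0 = 0"
  by (simp add: lin_fun_def)

lemma lin_fun_add: "lin_fun m (p + q) = lin_fun m p + lin_fun m q"
proof -
  let ?n = "max (degree p) (degree q)"
  have "lin_fun m (p + q) = (\<Sum>i\<le>?n. coeff (p + q) i * m i)"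
    by (rule lin_fun_altdef) (rule degree_add_le_max)
  also have "\<dots> = lin_fun m p + lin_fun m q"
    by (simp add: lin_fun_altdef[of p ?n] lin_fun_altdef[of q ?n] ring_distribs sum.distrib)
  finally show ?thesis .
qed

lemma lin_fun_smult: "lin_fun m (smult r p) = r * lin_fun m p"
  by (simp add: lin_fun_altdef[of "smult r p" "degree p"] lin_fun_def sum_distrib_left mult_ac)

lemma lin_fun_minus: "lin_fun m (- p) = - lin_fun m p"
  using lin_fun_smult[of m "-1" p] by simp

lemma lin_fun_diff: "lin_fun m (p - q) = lin_fun m p - lin_fun m q"
  using lin_fun_add[of m p "- q"] by (simp add: lin_fun_minus)

text \<open>Multiplication by x acts on the moment functional as a shift of the sequence; this is
  how the factor x in the recurrence of the linear forms raises k to \<open>Suc k\<close>.\<close>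

lemma lin_fun_pCons: "lin_fun m (pCons r p) = r * m 0 + lin_fun (\<lambda>i. m (Suc i)) p"
proof -
  have "lin_fun m (pCons r p) = (\<Sum>i\<le>Suc (degree p). coeff (pCons r p) i * m i)"
    by (rule lin_fun_altdef) (rule degree_pCons_le)
  then show ?thesis
    by (simp add: sum.atMost_Suc_shift lin_fun_def del: sum.atMost_Suc)
qed

lemma lin_fun_1: "lin_fun m 1 = m 0"
  by (simp add: one_pCons lin_fun_pCons)

lemmas lin_fun_simps = lin_fun_add lin_fun_diff lin_fun_smult lin_fun_minus lin_fun_pCons lin_fun_1

text \<open>The coefficients of a pair of polynomials, interleaved: the pairs admissible for index
  \<open>N\<close> are those whose interleaved coefficients vanish beyond \<open>N\<close>.\<close>
definition pair_coeff :: "real poly \<Rightarrow> real poly \<Rightarrow> nat \<Rightarrow> real" where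
  "pair_coeff P Q j = (if even j then coeff P (j div 2) else coeff Q (j div 2))"

lemma pair_coeff_even [simp]: "pair_coeff P Q (2 * i) = coeff P i"
  and pair_coeff_odd [simp]: "pair_coeff P Q (Suc (2 * i)) = coeff Q i"
  by (simp_all add: pair_coeff_def)

lemma pair_coeff_diff: "pair_coeff (P - P') (Q - Q') j = pair_coeff P Q j - pair_coeff P' Q' j"
  and pair_coeff_smult: "pair_coeff (smult r P) (smult r Q) j = r * pair_coeff P Q j"
  by (simp_all add: pair_coeff_def)

lemma pair_coeff_eq_0_imp:
  assumes "\<And>j. pair_coeff P Q j = 0"
  shows "P = 0 \<and> Q = 0"
proof -
  have "coeff P i = 0" "coeff Q i = 0" for i
    using assms[of "2 * i"] assms[of "Suc (2 * i)"] by simp_all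
  then show ?thesis
    by (auto simp: poly_eq_iff)
qed

text \<open>Slot 2i holds a coefficient of P and slot 2i + 1 one of Q, so both degree bounds,
  including the special case N = 0, become a single cutoff.\<close>

lemma pair_coeff_admissible_iff:
  "(degree P \<le> N div 2 \<and> (if N = 0 then Q = 0 else degree Q \<le> (N - 1) div 2)) \<longleftrightarrow>
     (\<forall>j>N. pair_coeff P Q j = 0)" (is "?L \<longleftrightarrow> ?R")
proof
  assume L: ?L
  show ?R
  proof (intro allI impI)
    fix j assume j: "j > N"
    show "pair_coeff P Q j = 0"
    proof (cases "even j")
      case True
      then show ?thesis
        using L j by (auto simp: coeff_eq_0 elim!: evenE)
    next
      case False
      then show ?thesis
        using L j by (auto simp: coeff_eq_0 split: if_splits elim!: oddE)
    qed
  qed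
next
  assume R: ?R
  have "degree P \<le> N div 2"
  proof (rule degree_le, intro allI impI)
    show "coeff P i = 0" if "i > N div 2" for i
      using R[rule_format, of "2 * i"] that by simp
  qed
  \<comment> \<open>For N = 0 this covers every i and gives Q = 0.\<close>
  moreover have "coeff Q i = 0" if "2 * i + 1 > N" for i
    using R[rule_format, of "Suc (2 * i)"] that by simp
  moreover have "2 * i + 1 > N" if "i > (N - 1) div 2" for i
    using that by linarith
  ultimately show ?L
    by (auto intro!: degree_le simp: poly_eq_iff)
qed

context hyp_params
begin

lemma moment_conv_lin_fun:
  "moment k P Q = lin_fun (\<lambda>i. m1 (k + i)) P + lin_fun (\<lambda>i. m2 (k + i)) Q"
  by (simp add: moment_def lin_fun_def)

lemma typeI_cond_iff:
  "typeI_cond a b c d N P Q \<longleftrightarrow> (\<forall>j>N. pair_coeff P Q j = 0) \<and>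
     (\<forall>k<N. moment k P Q = 0) \<and> moment N P Q = 1"
  unfolding pair_coeff_admissible_iff[symmetric]
  by (auto simp: typeI_cond_def set_integrable_qN set_integral_qN)

text \<open>Induction on the number N of available slots: subtracting the multiple r of
  \<open>(P N, Q N)\<close> that cancels the top slot leaves a pair with N slots and N vanishing
  moments, hence 0. The moment of index N then equals r, and it vanishes too.\<close>

lemma moments_eq_0_imp:
  assumes lead: "\<And>N. pair_coeff (P N) (Q N) N \<noteq> 0"
  assumes typeI: "\<And>N. typeI_cond a b c d N (P N) (Q N)"
  assumes "\<And>j. j \<ge> N \<Longrightarrow> pair_coeff A B j = 0" "\<And>k. k < N \<Longrightarrow> moment k A B = 0"
  shows "A = 0 \<and> B = 0"
  using assms(3,4)
proof (induction N arbitrary: A B)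
  case 0
  then show ?case
    by (intro pair_coeff_eq_0_imp) auto
next
  case (Suc N)
  define r where "r = pair_coeff A B N / pair_coeff (P N) (Q N) N"
  have PQ: "\<And>j. j > N \<Longrightarrow> pair_coeff (P N) (Q N) j = 0"
      "\<And>k. k < N \<Longrightarrow> moment k (P N) (Q N) = 0" "moment N (P N) (Q N) = 1"
    using typeI[of N] by (auto simp: typeI_cond_iff)
  have "A - smult r (P N) = 0 \<and> B - smult r (Q N) = 0"
  proof (rule Suc.IH)
    fix j assume "j \<ge> N"
    then show "pair_coeff (A - smult r (P N)) (B - smult r (Q N)) j = 0"
      using Suc.prems(1)[of j] PQ(1)[of j] lead[of N]
      by (cases "j = N") (auto simp: pair_coeff_diff pair_coeff_smult r_def)
  next
    fix k assume "k < N"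
    then show "moment k (A - smult r (P N)) (B - smult r (Q N)) = 0"
      using Suc.prems(2)[of k] PQ(2)[of k]
      by (simp add: moment_conv_lin_fun lin_fun_simps) algebra
  qed
  then have AB: "A = smult r (P N)" "B = smult r (Q N)"
    by auto
  have "moment N A B = r"
    using PQ(3) unfolding AB by (simp add: moment_conv_lin_fun lin_fun_simps flip: ring_distribs)
  then show ?case
    using AB Suc.prems(2)[of N] by simp
qed

text \<open>The difference of two solutions occupies the slots 0 to N and has vanishing moments 0 to
  N, so it is 0 and the definite description is determined.\<close>

lemma typeI_eqI:
  assumes "\<And>N. pair_coeff (P N) (Q N) N \<noteq> 0"
  assumes "\<And>N. typeI_cond a b c d N (P N) (Q N)"
  shows "typeI a b c d N = (P N, Q N)"
  unfolding typeI_def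
proof (rule the_equality)
  show "typeI_cond a b c d N (fst (P N, Q N)) (snd (P N, Q N))"
    using assms(2) by simp
next
  fix p assume p: "typeI_cond a b c d N (fst p) (snd p)"
  have "fst p - P N = 0 \<and> snd p - Q N = 0"
  proof (rule moments_eq_0_imp[where N = "Suc N", OF assms])
    show "pair_coeff (fst p - P N) (snd p - Q N) j = 0" if "j \<ge> Suc N" for j
      using p assms(2)[of N] that by (simp add: typeI_cond_iff pair_coeff_diff)
    have "moment k (fst p) (snd p) = moment k (P N) (Q N)" if "k < Suc N" for k
      using p assms(2)[of N] that by (cases "k = N") (auto simp: typeI_cond_iff)
    then show "moment k (fst p - P N) (snd p - Q N) = 0" if "k < Suc N" for k
      using that unfolding moment_conv_lin_fun lin_fun_simps by fastforce
  qed
  then show "p = (P N, Q N)"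
    by (simp add: prod_eq_iff)
qed

end

section \<open>The polynomials \<open>e\<^sub>n\<close> and the moments of the linear forms\<close>

text \<open>The index is shifted by 2, so that the recurrence also covers the vanishing
  initial values at \<open>-2\<close> and \<open>-1\<close>.\<close>
fun e_poly :: "nat \<Rightarrow> real poly" where
  "e_poly 0 = 0"
| "e_poly (Suc 0) = 0"
| "e_poly (Suc (Suc 0)) = 1"
| "e_poly (Suc (Suc (Suc n))) =
     pCons 0 (smult (19683/64) (e_poly (Suc n))) - smult (81/4) (e_poly (Suc (Suc n)))
     - smult (2187/16) (e_poly (Suc n)) - smult (19683/64) (e_poly n)"

text \<open>Coefficient comparison in series times denominator = 1. As 1/kappa = 27/4, the constants
  81/4, 2187/16 and 19683/64 are 3/kappa, 3/kappa^2 and 1/kappa^3.\<close>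

lemma e_rec:
  "e 0 x = 1"
  "e 1 x = - 81/4"
  "e 2 x = 19683/64 * x + 2187/8"
  "e (n + 3) x = 19683/64 * x * e (n + 1) x - 81/4 * e (n + 2) x - 2187/16 * e (n + 1) x
     - 19683/64 * e n x"
proof -
  define E where "E = e_gf x"
  define D where "D = (1 + fps_const (1/kappa) * fps_X) ^ 3 - fps_const (x / kappa ^ 3) * fps_X ^ 2"
  have "fps_nth D 0 = 1"
    by (simp add: D_def power3_eq_cube power2_eq_square)
  then have "E * D = 1"
    unfolding E_def e_gf_def D_def[symmetric] by (simp add: inverse_mult_eq_1)
  moreover have D: "D = 1 + fps_const (81/4) * fps_X + fps_const (2187/16 - 19683/64 * x) * fps_X ^ 2
      + fps_const (19683/64) * fps_X ^ 3"
  proof -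
    define A where "A = fps_const (27/4 :: real)"
    define B where "B = fps_const (19683/64 * x)"
    have "fps_const (81/4) = 3 * A" "fps_const (2187/16 - 19683/64 * x) = 3 * A ^ 2 - B"
        "fps_const (19683/64) = A ^ 3"
      by (simp_all add: A_def B_def fps_numeral_fps_const fps_const_power power2_eq_square power3_eq_cube)
    moreover have "D = (1 + A * fps_X) ^ 3 - B * fps_X ^ 2"
      by (simp add: D_def A_def B_def kappa_def power3_eq_cube mult.commute)
    moreover have "(1 + u * v) ^ 3 - w * v ^ 2 = 1 + 3 * u * v + (3 * u ^ 2 - w) * v ^ 2 + u ^ 3 * v ^ 3"
      for u v w :: "real fps"
      by (simp add: power3_eq_cube power2_eq_square algebra_simps)
    ultimately show ?thesis
      by metis
  qed
  moreover have "E * (1 + p * X + q * X ^ 2 + r * X ^ 3) =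
      E + p * (X * E) + q * (X ^ 2 * E) + r * (X ^ 3 * E)" for p q r X
    by (simp add: algebra_simps)
  ultimately have *: "E + fps_const (81/4) * (fps_X * E) + fps_const (2187/16 - 19683/64 * x) * (fps_X ^ 2 * E)
      + fps_const (19683/64) * (fps_X ^ 3 * E) = 1"
    by metis
  \<comment> \<open>The conditionals set coefficients of negative index to 0, so one identity yields
    both the initial values and the recurrence.\<close>
  have nth: "fps_nth E k + 81/4 * (if k = 0 then 0 else fps_nth E (k - 1))
      + (2187/16 - 19683/64 * x) * (if k < 2 then 0 else fps_nth E (k - 2))
      + 19683/64 * (if k < 3 then 0 else fps_nth E (k - 3)) = (if k = 0 then 1 else 0)" for k
    using arg_cong[OF *, of "\<lambda>f. fps_nth f k"]
    by (simp only: fps_add_nth fps_mult_left_const_nth fps_X_power_mult_nth fps_X_mult_nth fps_one_nth)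
  have e: "e k x = fps_nth E k" for k
    by (simp add: e_def E_def)
  show 0: "e 0 x = 1"
    using nth[of 0] by (simp add: e)
  show 1: "e 1 x = - 81/4"
    using nth[of 1] 0 by (simp add: e)
  show "e 2 x = 19683/64 * x + 2187/8"
    using nth[of 2] 0 1 by (simp add: e)
  show "e (n + 3) x = 19683/64 * x * e (n + 1) x - 81/4 * e (n + 2) x - 2187/16 * e (n + 1) x
     - 19683/64 * e n x"
    using nth[of "n + 3"] by (simp add: e algebra_simps numeral_eq_Suc)
qed

lemma poly_e_poly: "poly (e_poly (Suc (Suc n))) x = e n x"
proof (induction n rule: less_induct)
  case (less n)
  consider "n = 0" | "n = 1" | "n = 2" | m where "n = m + 3"
  proof -
    have "n = 0 \<or> n = 1 \<or> n = 2 \<or> n = n - 3 + 3"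
      by linarith
    then show ?thesis
      using that by blast
  qed
  then show ?case
  proof cases
    case 1
    then show ?thesis
      by (simp add: e_rec)
  next
    case 2
    then show ?thesis
      using e_rec(2)[of x] by simp
  next
    case 3
    have "e_poly (Suc (Suc (Suc (Suc 0)))) = pCons 0 [:19683/64:] + [:2187/8:]"
      by (simp add: one_pCons)
    then show ?thesis
      using e_rec(3)[of x] 3 by (simp add: numeral_2_eq_2 algebra_simps del: e_poly.simps)
  next
    case 4
    have "e_poly (Suc (Suc n)) =
      pCons 0 (smult (19683/64) (e_poly (Suc (Suc (m + 1))))) - smult (81/4) (e_poly (Suc (Suc (m + 2))))
      - smult (2187/16) (e_poly (Suc (Suc (m + 1)))) - smult (19683/64) (e_poly (Suc (Suc m)))"
      by (simp add: 4 numeral_eq_Suc)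
    then have "poly (e_poly (Suc (Suc n))) x = x * (19683/64 * e (m + 1) x) - 81/4 * e (m + 2) x
        - 2187/16 * e (m + 1) x - 19683/64 * e m x"
      using less.IH[of "m + 1"] less.IH[of "m + 2"] less.IH[of m] 4 by simp
    then show ?thesis
      using e_rec(4)[of m x] 4 by simp
  qed
qed

text \<open>In the recurrence each factor x costs two index steps. Thus e_n has degree at most n/2,
  and for n = 2i its leading coefficient is (1/kappa^3)^i.\<close>

lemma coeff_e_poly:
  "n < 2 * i + 2 \<Longrightarrow> coeff (e_poly n) i = 0"
  "coeff (e_poly (2 * i + 2)) i = (19683/64) ^ i"
proof -
  show 1: "coeff (e_poly n) i = 0" if "n < 2 * i + 2" for n i
    using that
  proof (induction n arbitrary: i rule: e_poly.induct)
    case (4 n)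
    then show ?case
      by (cases i) (auto simp: coeff_pCons)
  qed (auto simp: coeff_eq_0)
  show "coeff (e_poly (2 * i + 2)) i = (19683/64) ^ i"
  proof (induction i)
    case (Suc i)
    have "e_poly (2 * Suc i + 2) = e_poly (Suc (Suc (Suc (2 * i + 1))))"
      by simp
    also have "coeff \<dots> (Suc i) = 19683/64 * coeff (e_poly (2 * i + 2)) i"
      by (simp add: 1 coeff_pCons del: e_poly.simps) (simp add: 1)
    finally show ?case
      using Suc by simp
  qed (simp add: numeral_2_eq_2)
qed

section \<open>Coefficients of powers of 1 + kappa X as candidate moments\<close>

lemma coeff_one_plus_power:
  "fps_nth ((1 + fps_const r * fps_X) ^ n) k = of_nat (n choose k) * (r :: 'a :: comm_ring_1) ^ k"
proof (induction n arbitrary: k)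
  case 0
  then show ?case
    by (cases k) auto
next
  case (Suc n)
  have "fps_nth ((1 + fps_const r * fps_X) ^ Suc n) k =
      fps_nth ((1 + fps_const r * fps_X) ^ n) k + r * (if k = 0 then 0 else fps_nth ((1 + fps_const r * fps_X) ^ n) (k - 1))"
    by (simp only: power_Suc ring_distribs mult_1 mult.assoc fps_add_nth fps_mult_left_const_nth fps_X_mult_nth)
  then show ?case
    unfolding Suc.IH by (cases k) (simp_all add: algebra_simps)
qed

text \<open>With \<open>x = \<kappa> (1 + u)\<^sup>3 / u\<close> and \<open>u = \<kappa> X\<close>, this is the constant term of \<open>x\<^sup>k X\<^sup>N \<phi>(X)\<close>.\<close>
definition moment_seq :: "real fps \<Rightarrow> nat \<Rightarrow> nat \<Rightarrow> real" where
  "moment_seq \<phi> N k = fps_nth (fps_X ^ N * ((1 + fps_const (4/27) * fps_X) ^ (3 * k) * \<phi>)) k"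

lemma moment_seq_eq_0: "k < N \<Longrightarrow> moment_seq \<phi> N k = 0"
  by (simp add: moment_seq_def fps_X_power_mult_nth)

lemma moment_seq_diag: "moment_seq \<phi> N N = fps_nth \<phi> 0"
  by (simp add: moment_seq_def fps_X_power_mult_nth fps_power_zeroth)

text \<open>Raising k by one multiplies the series by (1 + kappa X)^3, whose expansion supplies the
  constants 3 kappa, 3 kappa^2 and kappa^3; each further X raises N.\<close>

lemma moment_seq_rec:
  "moment_seq \<phi> (Suc N) (Suc k) = moment_seq \<phi> N k + 4/9 * moment_seq \<phi> (Suc N) k
     + 16/243 * moment_seq \<phi> (Suc (Suc N)) k + 64/19683 * moment_seq \<phi> (Suc (Suc (Suc N))) k"
proof -
  define A where "A = fps_const (4/27 :: real)"
  define Y where "Y = fps_X ^ N * ((1 + A * fps_X) ^ (3 * k) * \<phi>)"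
  have A: "fps_const (4/9) = 3 * A" "fps_const (16/243) = 3 * A ^ 2" "fps_const (64/19683) = A ^ 3"
    by (simp_all add: A_def fps_numeral_fps_const power2_eq_square power3_eq_cube)
  have "moment_seq \<phi> (Suc N) (Suc k) = fps_nth (fps_X * ((1 + A * fps_X) ^ 3 * Y)) (Suc k)"
    by (simp add: moment_seq_def A_def Y_def power_add mult_ac)
  also have "\<dots> = fps_nth ((1 + A * fps_X) ^ 3 * Y) k"
    by (simp only: fps_X_mult_nth) simp
  also have "(1 + A * fps_X) ^ 3 * Y = Y + (3 * A) * (fps_X * Y) + (3 * A ^ 2) * (fps_X * (fps_X * Y))
      + A ^ 3 * (fps_X * (fps_X * (fps_X * Y)))"
    by (simp add: power3_eq_cube power2_eq_square algebra_simps)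
  also have "fps_nth \<dots> k = fps_nth Y k + 4/9 * fps_nth (fps_X * Y) k
      + 16/243 * fps_nth (fps_X * (fps_X * Y)) k + 64/19683 * fps_nth (fps_X * (fps_X * (fps_X * Y))) k"
    by (simp only: A[symmetric] fps_add_nth fps_mult_left_const_nth)
  finally show ?thesis
    by (simp only: Y_def A_def moment_seq_def power_Suc mult.assoc)
qed

text \<open>Here \<open>moment_seq \<phi> 0 k\<close> is the binomial coefficient (3k + \<alpha>
  over k) times kappa^k. Its ratio in k, cleared of denominators, is later matched with that of
  \<open>m1\<close>.\<close>

lemma moment_seq_power_Suc_0:
  fixes \<alpha> :: nat
  defines "\<phi> \<equiv> (1 + fps_const (4/27) * fps_X) ^ \<alpha>"
  shows "moment_seq \<phi> 0 (Suc k) * (27 * ((real k + 1) * (2 * real k + \<alpha> + 2) * (2 * real k + \<alpha> + 1))) =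
         moment_seq \<phi> 0 k * (4 * ((3 * real k + \<alpha> + 3) * (3 * real k + \<alpha> + 2) * (3 * real k + \<alpha> + 1)))"
proof -
  have T: "moment_seq \<phi> 0 k = fact (3 * k + \<alpha>) / (fact k * fact (2 * k + \<alpha>)) * (4/27) ^ k" for k
    by (simp add: moment_seq_def \<phi>_def binomial_fact coeff_one_plus_power flip: power_add)
  have "fact (3 * Suc k + \<alpha>) = (fact (3 * k + \<alpha>) :: real) * ((3 * k + \<alpha> + 3) * (3 * k + \<alpha> + 2) * (3 * k + \<alpha> + 1))"
    by (simp add: numeral_eq_Suc algebra_simps)
  moreover have "fact (2 * Suc k + \<alpha>) = (fact (2 * k + \<alpha>) :: real) * ((2 * k + \<alpha> + 2) * (2 * k + \<alpha> + 1))"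
    by (simp add: numeral_eq_Suc algebra_simps)
  moreover have "real k + 1 > 0" "2 * real k + \<alpha> + 1 > 0" "2 * real k + \<alpha> + 2 > 0"
    by simp_all
  ultimately show ?thesis
    unfolding T fact_Suc[of k] by (simp add: divide_simps) (simp add: algebra_simps)
qed

text \<open>For k > N both values are neighbouring binomial coefficients in row 3k + \<alpha>, times
  powers of kappa. For k = N the factor \<open>real k - N\<close> and the left value vanish; for k <
  N both values do.\<close>

lemma moment_seq_power_Suc:
  fixes \<alpha> :: nat
  defines "\<phi> \<equiv> (1 + fps_const (4/27) * fps_X) ^ \<alpha>"
  shows "moment_seq \<phi> (Suc N) k * (4 * (2 * real k + \<alpha> + N + 1)) = moment_seq \<phi> N k * (27 * (real k - N))"
proof (cases "k > N")
  case True
  then obtain j where k: "k = Suc (N + j)"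
    using less_imp_Suc_add by blast
  have T: "moment_seq \<phi> N k = (if k < N then 0 else real ((3 * k + \<alpha>) choose (k - N)) * (4/27) ^ (k - N))" for N
    by (simp add: moment_seq_def \<phi>_def fps_X_power_mult_nth coeff_one_plus_power flip: power_add)
  have "(3 * k + \<alpha> - j) * ((3 * k + \<alpha>) choose j) = Suc j * ((3 * k + \<alpha>) choose Suc j)"
    using binomial_absorb_comp[of "3 * k + \<alpha>" j] binomial_absorption[of j "3 * k + \<alpha>"] by simp
  moreover have "3 * k + \<alpha> - j = 2 * k + \<alpha> + N + 1"
    by (simp add: k)
  ultimately have "real ((2 * k + \<alpha> + N + 1) * ((3 * k + \<alpha>) choose j)) = real (Suc j * ((3 * k + \<alpha>) choose Suc j))"
    by simp
  then have "(2 * real k + \<alpha> + N + 1) * ((3 * k + \<alpha>) choose j) = (real k - N) * ((3 * k + \<alpha>) choose Suc j)"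
    unfolding of_nat_mult by (simp add: k)
  moreover have "moment_seq \<phi> (Suc N) k = ((3 * k + \<alpha>) choose j) * (4/27) ^ j"
    unfolding T by (simp add: k)
  moreover have "27 * moment_seq \<phi> N k = 4 * (((3 * k + \<alpha>) choose Suc j) * (4/27) ^ j)"
    unfolding T by (simp add: k)
  \<comment> \<open>C and D stand for the two binomial coefficients and q for the power
    \<open>(4/27) ^ j\<close>.\<close>
  moreover have "M' * (4 * A) = M * (27 * B)"
    if "A * C = B * D" "M' = C * q" "27 * M = 4 * (D * q)" for A B C D M M' q :: real
    using that by algebra
  ultimately show ?thesis
    by blast
next
  case False
  then show ?thesis
    by (cases "k = N") (auto simp: moment_seq_eq_0)
qed

section \<open>The closed form of the type I polynomials from matching initial moments\<close>

text \<open>\<alpha> and \<epsilon> select the series \<open>\<phi>\<close>;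
  \<open>\<alpha>0\<close>, \<open>\<alpha>0'\<close>, \<open>\<alpha>1\<close>,
  \<open>\<beta>0\<close>, \<open>\<beta>1\<close> are the coefficients in the claimed formulas. At
  y = k, \<open>r\<close> is the quotient of the moment sequences of \<open>\<phi>\<close> and
  \<open>\<psi>\<close> for N = 0. \<open>moments_0\<close> equates the ratios in k of
  \<open>m1\<close> and of that moment sequence; \<open>moments_1\<close> and
  \<open>moments_2\<close> match the forms N = 1 and N = 2. All three are rational identities in y,
  and \<open>lead\<close> keeps the top coefficients nonzero.\<close>

locale type_I_formula = hyp_params +
  fixes \<alpha> :: nat and \<epsilon> \<alpha>0 \<alpha>0' \<alpha>1 \<beta>0 \<beta>1 :: real and r :: "real \<Rightarrow> real"
  defines "r \<equiv> \<lambda>y::real. 1 - 2 * \<epsilon> * (y / (2 * y + \<alpha> + 1))"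
  assumes lead: "\<alpha>0' \<noteq> - 19683/64" "\<beta>1 \<noteq> 0"
    and moments_0: "\<And>y::real. y \<ge> 0 \<Longrightarrow>
      4 * r (y + 1) * ((3 * y + \<alpha> + 3) * (3 * y + \<alpha> + 2) * (3 * y + \<alpha> + 1)) * ((c + y) * (d + y)) =
      27 * r y * ((y + 1) * (2 * y + \<alpha> + 2) * (2 * y + \<alpha> + 1)) * ((a + y) * (b + y))"
    and moments_1: "\<And>y::real. y \<ge> 0 \<Longrightarrow>
      (\<alpha>1 - 81/4 + \<beta>1 * (c * (b + y) / (b * (c + y)))) * r y =
      27/4 * (y / (2 * y + \<alpha> + 1)) * (1 - 2 * \<epsilon> * ((y - 1) / (2 * y + \<alpha> + 2)))"
    and moments_2: "\<And>y::real. y \<ge> 0 \<Longrightarrow>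
      (\<alpha>0 - 81/4 * \<alpha>1 + 2187/8 + (\<alpha>0' + 19683/64) * ((a + y) * (b + y) / ((c + y) * (d + y)))
         + (\<beta>0 - 81/4 * \<beta>1) * (c * (b + y) / (b * (c + y)))) * r y =
      (27/4)\<^sup>2 * (y / (2 * y + \<alpha> + 1)) * ((y - 1) / (2 * y + \<alpha> + 2))
         * (1 - 2 * \<epsilon> * ((y - 2) / (2 * y + \<alpha> + 3)))"
begin

text \<open>As \<open>e_poly N\<close> is e_(N-2), this is the candidate for index N itself; for N =
  0 and N = 1 the terms with negative index drop out.\<close>

definition P :: "nat \<Rightarrow> real poly" where
  "P N = smult \<alpha>0 (e_poly N) + pCons 0 (smult \<alpha>0' (e_poly N)) + smult \<alpha>1 (e_poly (Suc N)) + e_poly (Suc (Suc N))"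

definition Q :: "nat \<Rightarrow> real poly" where
  "Q N = smult \<beta>0 (e_poly N) + smult \<beta>1 (e_poly (Suc N))"

definition \<psi> :: "real fps" where
  "\<psi> = (1 + fps_const (4/27) * fps_X) ^ \<alpha>"

definition \<phi> :: "real fps" where
  "\<phi> = \<psi> * (1 - fps_const (8/27 * \<epsilon>) * fps_X)"

lemma pair_coeff_PQ: "j > N \<Longrightarrow> pair_coeff (P N) (Q N) j = 0"
proof (cases "even j")
  case True
  assume "j > N"
  with True obtain i where "j = 2 * i" "N < 2 * i"
    by (auto elim!: evenE)
  then show ?thesis
    by (auto simp: P_def coeff_e_poly coeff_pCons split: nat.splits)
next
  case False
  assume "j > N"
  with False obtain i where "j = Suc (2 * i)" "N < Suc (2 * i)"
    by (auto elim!: oddE)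
  then show ?thesis
    by (auto simp: Q_def coeff_e_poly)
qed

text \<open>For even N > 0 only x e_(N-2) and e_N reach the top slot, which gives the factor
  \<open>\<alpha>0' + 19683/64\<close>; for odd N only the multiple \<open>\<beta>1\<close> of
  e_(N-1) does. For N = 0 the entry is 1.\<close>

lemma pair_coeff_PQ_lead: "pair_coeff (P N) (Q N) N \<noteq> 0"
proof (cases "even N")
  case True
  then obtain i where N: "N = 2 * i"
    by (auto elim!: evenE)
  show ?thesis
  proof (cases i)
    case 0
    then show ?thesis
      by (simp add: N P_def pair_coeff_def)
  next
    case (Suc m)
    have "pair_coeff (P N) (Q N) N = coeff (P (2 * i)) i"
      by (simp add: N)
    also have "\<dots> = \<alpha>0' * coeff (e_poly (2 * m + 2)) m + coeff (e_poly (2 * i + 2)) i"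
      using coeff_e_poly(1)[of "2 * i" i] coeff_e_poly(1)[of "Suc (2 * i)" i]
      unfolding P_def by (simp add: Suc del: e_poly.simps)
    also have "\<dots> = (\<alpha>0' + 19683/64) * (19683/64) ^ m"
      unfolding coeff_e_poly(2) by (simp add: Suc algebra_simps)
    finally show ?thesis
      using lead(1) by auto
  qed
next
  case False
  then obtain i where N: "N = Suc (2 * i)"
    by (auto elim!: oddE)
  then have "pair_coeff (P N) (Q N) N = coeff (Q (Suc (2 * i))) i"
    by simp
  also have "\<dots> = \<beta>1 * coeff (e_poly (2 * i + 2)) i"
    using coeff_e_poly(1)[of "Suc (2 * i)" i]
    unfolding Q_def by (simp del: e_poly.simps)
  finally show ?thesis
    unfolding coeff_e_poly(2) using lead(2) by simp
qed

text \<open>\<open>P\<close> and \<open>Q\<close> inherit the recurrence of \<open>e_poly\<close>,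
  since they combine its shifts with coefficients independent of N.\<close>

lemma moment_rec:
  "moment k (P (N + 3)) (Q (N + 3)) = 19683/64 * moment (Suc k) (P (N + 1)) (Q (N + 1))
     - 81/4 * moment k (P (N + 2)) (Q (N + 2)) - 2187/16 * moment k (P (N + 1)) (Q (N + 1))
     - 19683/64 * moment k (P N) (Q N)"
proof -
  have rec: "X (N + 3) = pCons 0 (smult (19683/64) (X (N + 1))) - smult (81/4) (X (N + 2))
      - smult (2187/16) (X (N + 1)) - smult (19683/64) (X N)"
    if "X = P \<or> X = Q" for X
    using that by (auto simp: P_def Q_def numeral_eq_Suc[of "num.Bit0 _"] numeral_3_eq_3
        smult_add_right smult_diff_right smult_smult mult_ac algebra_simps)
  show ?thesis
    unfolding rec[of P, OF disjI1[OF refl]] rec[of Q, OF disjI2[OF refl]]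
    by (simp add: moment_conv_lin_fun lin_fun_simps algebra_simps)
qed

lemma moment_seq_\<phi>: "moment_seq \<phi> N k = moment_seq \<psi> N k - 8/27 * \<epsilon> * moment_seq \<psi> (Suc N) k"
proof -
  have "fps_X ^ N * ((1 + fps_const (4/27) * fps_X) ^ (3 * k) * \<phi>) =
      fps_X ^ N * ((1 + fps_const (4/27) * fps_X) ^ (3 * k) * \<psi>) - fps_const (8/27 * \<epsilon>) *
      (fps_X ^ Suc N * ((1 + fps_const (4/27) * fps_X) ^ (3 * k) * \<psi>))"
    by (simp add: \<phi>_def algebra_simps)
  then show ?thesis
    unfolding moment_seq_def by (simp only: fps_sub_nth fps_mult_left_const_nth)
qed

lemma moment_seq_\<psi>_Suc:
  "moment_seq \<psi> (Suc N) k = 27/4 * ((real k - N) / (2 * real k + \<alpha> + N + 1)) * moment_seq \<psi> N k"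
proof -
  have "2 * real k + \<alpha> + N + 1 > 0"
    by simp
  then show ?thesis
    using moment_seq_power_Suc[of \<alpha> N k, folded \<psi>_def] by (simp add: divide_simps)
qed

text \<open>Both sides are 1 at k = 0 and, by \<open>moments_0\<close>, satisfy the same first-order
  recurrence in k.\<close>

lemma m1_eq: "m1 k = r k * moment_seq \<psi> 0 k"
proof (induction k)
  case 0
  then show ?case
    by (simp add: m1_def r_def moment_seq_diag \<psi>_def fps_power_zeroth)
next
  case (Suc k)
  have *: "c + k > 0" "d + k > 0" "real k + 1 > 0" "2 * real k + \<alpha> + 2 > 0" "2 * real k + \<alpha> + 1 > 0"
    using pos by auto
  have 1: "m1 (Suc k) * ((c + k) * (d + k)) = m1 k * ((a + k) * (b + k))"
    using * pochhammer_pos[of c k] pochhammer_pos[of d k] pos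
    by (simp add: m1_def pochhammer_Suc divide_simps)
  let ?u = "27 * ((real k + 1) * (2 * real k + \<alpha> + 2) * (2 * real k + \<alpha> + 1))"
  let ?v = "4 * ((3 * real k + \<alpha> + 3) * (3 * real k + \<alpha> + 2) * (3 * real k + \<alpha> + 1))"
  let ?cd = "(c + k) * (d + k)" and ?ab = "(a + k) * (b + k)"
  have 2: "moment_seq \<psi> 0 (Suc k) * ?u = moment_seq \<psi> 0 k * ?v"
    unfolding \<psi>_def by (rule moment_seq_power_Suc_0)
  have "real (Suc k) = real k + 1"
    by simp
  then have 3: "r (Suc k) * ?v * ?cd = r k * ?u * ?ab"
    using moments_0[OF of_nat_0_le_iff[of k]] by (simp only: mult_ac)
  have "m1 (Suc k) * ?cd * ?u = r (Suc k) * moment_seq \<psi> 0 (Suc k) * ?cd * ?u"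
    using 1 2 3 Suc.IH by algebra
  moreover have "?cd * ?u \<noteq> 0"
    using * by auto
  ultimately show ?case
    by auto
qed

lemma m1_Suc: "m1 (Suc k) = ((a + k) * (b + k) / ((c + k) * (d + k))) * m1 k"
  by (simp add: m1_def pochhammer_Suc mult_ac)

text \<open>Both sides satisfy the same third-order recurrence in N. It also involves
  \<open>Suc k\<close>, so the induction keeps k arbitrary; N = 0, 1, 2 are the initial
  values.\<close>

lemma moment_PQ: "moment k (P N) (Q N) = moment_seq \<phi> N k"
proof (induction N arbitrary: k rule: less_induct)
  case (less N)
  let ?t = "moment_seq \<psi> 0 k"
  define \<rho>1 \<rho>2 \<rho>3 where "\<rho>1 = real k / (2 * real k + \<alpha> + 1)"
    and "\<rho>2 = (real k - 1) / (2 * real k + \<alpha> + 2)"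
    and "\<rho>3 = (real k - 2) / (2 * real k + \<alpha> + 3)"
  note \<rho> = this[symmetric]
  \<comment> \<open>Three steps suffice: the initial cases end at N = 2, and \<open>\<phi>\<close>
    mixes the indices N and N + 1 of \<open>\<psi>\<close>.\<close>
  have \<psi>: "moment_seq \<psi> (Suc 0) k = 27/4 * \<rho>1 * ?t"
      "moment_seq \<psi> (Suc (Suc 0)) k = 27/4 * \<rho>2 * (27/4 * \<rho>1 * ?t)"
      "moment_seq \<psi> (Suc (Suc (Suc 0))) k = 27/4 * \<rho>3 * (27/4 * \<rho>2 * (27/4 * \<rho>1 * ?t))"
    by (simp_all add: moment_seq_\<psi>_Suc \<rho>1_def \<rho>2_def \<rho>3_def add_ac)
  consider "N = 0" | "N = 1" | "N = 2" | n where "N = n + 3"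
  proof -
    have "N = 0 \<or> N = 1 \<or> N = 2 \<or> N = N - 3 + 3"
      by linarith
    then show ?thesis
      using that by blast
  qed
  then show ?case
  proof cases
    case 1
    have "moment k (P N) (Q N) = m1 k"
      by (simp add: 1 P_def Q_def moment_conv_lin_fun lin_fun_1)
    also have "\<dots> = moment_seq \<phi> N k"
      unfolding m1_eq moment_seq_\<phi> 1 r_def \<rho> by (simp add: \<psi> algebra_simps)
    finally show ?thesis .
  next
    case 2
    have "moment k (P N) (Q N) = (\<alpha>1 - 81/4) * m1 k + \<beta>1 * m2 k"
      by (simp add: 2 P_def Q_def moment_conv_lin_fun lin_fun_simps algebra_simps)
    also have "\<dots> = (\<alpha>1 - 81/4 + \<beta>1 * (c * (b + k) / (b * (c + k)))) * m1 k"
      by (simp only: m2_def ring_distribs mult_ac)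
    also have "\<dots> = moment_seq \<phi> N k"
      unfolding m1_eq mult.assoc[symmetric] moments_1[OF of_nat_0_le_iff] 2 \<rho>
      by (simp add: \<psi> moment_seq_\<phi> numeral_2_eq_2 field_simps)
    finally show ?thesis .
  next
    case 3
    \<comment> \<open>The values e_1 = -81/4 and e_2 = 19683/64 x + 2187/8 are inserted; the terms
      with x contribute \<open>m1 (Suc k)\<close>.\<close>
    have "moment k (P N) (Q N) = (\<alpha>0 - 81/4 * \<alpha>1 + 2187/8) * m1 k
        + (\<alpha>0' + 19683/64) * m1 (Suc k) + (\<beta>0 - 81/4 * \<beta>1) * m2 k"
      by (simp add: 3 numeral_2_eq_2 P_def Q_def moment_conv_lin_fun lin_fun_simps algebra_simps)
    also have "\<dots> = (\<alpha>0 - 81/4 * \<alpha>1 + 2187/8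
         + (\<alpha>0' + 19683/64) * ((a + k) * (b + k) / ((c + k) * (d + k)))
         + (\<beta>0 - 81/4 * \<beta>1) * (c * (b + k) / (b * (c + k)))) * m1 k"
      by (simp only: m2_def m1_Suc ring_distribs mult_ac)
    also have "\<dots> = moment_seq \<phi> N k"
      unfolding m1_eq mult.assoc[symmetric] moments_2[OF of_nat_0_le_iff] 3 \<rho> power2_eq_square
      by (simp only: \<psi> moment_seq_\<phi> numeral_2_eq_2) algebra
    finally show ?thesis .
  next
    case 4
    have "moment k (P (n + 3)) (Q (n + 3)) = 19683/64 * moment_seq \<phi> (n + 1) (Suc k)
       - 81/4 * moment_seq \<phi> (n + 2) k - 2187/16 * moment_seq \<phi> (n + 1) k - 19683/64 * moment_seq \<phi> n k"
      unfolding moment_rec by (simp add: less.IH 4)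
    also have "\<dots> = moment_seq \<phi> (n + 3) k"
    proof -
      have "n + 1 = Suc n" "n + 2 = Suc (Suc n)" "n + 3 = Suc (Suc (Suc n))"
        by simp_all
      then show ?thesis
        using moment_seq_rec[of \<phi> n k] by (simp only:) (simp add: field_simps)
    qed
    finally show ?thesis
      by (simp add: 4)
  qed
qed

text \<open>The factor \<open>fps_X ^ N\<close> in \<open>moment_seq\<close> gives orthogonality,
  and the constant term 1 of \<open>\<phi>\<close> gives the normalization.\<close>

lemma typeI_cond_PQ: "typeI_cond a b c d N (P N) (Q N)"
  by (auto simp: typeI_cond_iff pair_coeff_PQ moment_PQ moment_seq_eq_0 moment_seq_diag
      \<phi>_def \<psi>_def fps_power_zeroth)

lemma
  shows poly_A1: "poly (A1 a b c d (n + 2)) x = (\<alpha>0 + \<alpha>0' * x) * e n x + \<alpha>1 * e (n + 1) x + e (n + 2) x"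
    and poly_A2: "poly (A2 a b c d (n + 2)) x = \<beta>0 * e n x + \<beta>1 * e (n + 1) x"
proof -
  have "typeI a b c d (n + 2) = (P (n + 2), Q (n + 2))"
    by (intro typeI_eqI typeI_cond_PQ pair_coeff_PQ_lead)
  then show "poly (A1 a b c d (n + 2)) x = (\<alpha>0 + \<alpha>0' * x) * e n x + \<alpha>1 * e (n + 1) x + e (n + 2) x"
      "poly (A2 a b c d (n + 2)) x = \<beta>0 * e n x + \<beta>1 * e (n + 1) x"
    by (simp_all add: A1_def A2_def P_def Q_def poly_e_poly algebra_simps del: e_poly.simps)
qed

end

section \<open>The twelve parameter tuples\<close>

text \<open>The tuples come in pairs that exchange a and b. As \<open>m1\<close> is symmetric in a
  and b, the two members of a pair share \<alpha> and \<epsilon>; the six pairs run through all six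
  choices of these.\<close>

interpretation formula_1: type_I_formula "1/3" "2/3" "1/2" "1" 0 0 "729/4" "-6561/32" "135/4" "-729/8" "-27/2"
    "\<lambda>y. 1 - 2 * 0 * (y / (2 * y + real 0 + 1))"
  by unfold_locales (simp_all add: delta_def divide_simps, algebra+)

interpretation formula_2: type_I_formula "2/3" "1/3" "1/2" "1" 0 0 "729/16" "-6561/32" "27/2" "729/16" "27/4"
    "\<lambda>y. 1 - 2 * 0 * (y / (2 * y + real 0 + 1))"
  by unfold_locales (simp_all add: delta_def divide_simps, algebra+)

interpretation formula_3: type_I_formula "2/3" "4/3" "1" "3/2" 1 0 "-3645/16" "0" "135/4" "729/4" "-27/2"
    "\<lambda>y. 1 - 2 * 0 * (y / (2 * y + real 1 + 1))"
  by unfold_locales (simp_all add: delta_def divide_simps, algebra+)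

interpretation formula_4: type_I_formula "4/3" "2/3" "1" "3/2" 1 0 "729/16" "0" "27/2" "-729/8" "27/4"
    "\<lambda>y. 1 - 2 * 0 * (y / (2 * y + real 1 + 1))"
  by unfold_locales (simp_all add: delta_def divide_simps, algebra+)

interpretation formula_5: type_I_formula "4/3" "5/3" "3/2" "2" 2 0 "-729/8" "0" "54" "0" "-135/4"
    "\<lambda>y. 1 - 2 * 0 * (y / (2 * y + real 2 + 1))"
  by unfold_locales (simp_all add: delta_def divide_simps, algebra+)

interpretation formula_6: type_I_formula "5/3" "4/3" "3/2" "2" 2 0 "-729/8" "0" "-27/4" "0" "27"
    "\<lambda>y. 1 - 2 * 0 * (y / (2 * y + real 2 + 1))"
  by unfold_locales (simp_all add: delta_def divide_simps, algebra+)

interpretation formula_7: type_I_formula "1/3" "2/3" "1" "3/2" 0 1 "-729/8" "0" "-27/4" "729/4" "27"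
    "\<lambda>y. 1 - 2 * 1 * (y / (2 * y + real 0 + 1))"
  by unfold_locales (simp_all add: delta_def divide_simps, algebra+)

interpretation formula_8: type_I_formula "2/3" "1/3" "1" "3/2" 0 1 "729/16" "0" "27/2" "729/16" "27/4"
    "\<lambda>y. 1 - 2 * 1 * (y / (2 * y + real 0 + 1))"
  by unfold_locales (simp_all add: delta_def divide_simps, algebra+)

interpretation formula_9: type_I_formula "2/3" "4/3" "3/2" "2" 1 1 "729/16" "0" "-189/4" "0" "135/2"
    "\<lambda>y. 1 - 2 * 1 * (y / (2 * y + real 1 + 1))"
  by unfold_locales (simp_all add: delta_def divide_simps, algebra+)

interpretation formula_10: type_I_formula "4/3" "2/3" "3/2" "2" 1 1 "729/16" "0" "27/2" "0" "27/4"
    "\<lambda>y. 1 - 2 * 1 * (y / (2 * y + real 1 + 1))"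
  by unfold_locales (simp_all add: delta_def divide_simps, algebra+)

interpretation formula_11: type_I_formula "4/3" "5/3" "2" "5/2" 2 1 "0" "0" "-27/2" "0" "135/4"
    "\<lambda>y. 1 - 2 * 1 * (y / (2 * y + real 2 + 1))"
  by unfold_locales (simp_all add: delta_def divide_simps, algebra+)

interpretation formula_12: type_I_formula "5/3" "4/3" "2" "5/2" 2 1 "0" "0" "27/4" "0" "27/2"
    "\<lambda>y. 1 - 2 * 1 * (y / (2 * y + real 2 + 1))"
  by unfold_locales (simp_all add: delta_def divide_simps, algebra+)

theorem theorem16:
  fixes n :: nat and x :: real
  shows
   "(poly (A1 (1/3) (2/3) (1/2) (1) (n+2)) x = (729/4 - 6561*x/32) * e n x + 135/4 * e (n+1) x + e (n+2) x \<and>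
     poly (A2 (1/3) (2/3) (1/2) (1) (n+2)) x = - 729/8 * e n x - 27/2 * e (n+1) x) \<and>
    (poly (A1 (2/3) (1/3) (1/2) (1) (n+2)) x = (729/16 - 6561*x/32) * e n x + 27/2 * e (n+1) x + e (n+2) x \<and>
     poly (A2 (2/3) (1/3) (1/2) (1) (n+2)) x = 729/16 * e n x + 27/4 * e (n+1) x) \<and>
    (poly (A1 (2/3) (4/3) (1) (3/2) (n+2)) x = - 3645/16 * e n x + 135/4 * e (n+1) x + e (n+2) x \<and>
     poly (A2 (2/3) (4/3) (1) (3/2) (n+2)) x = 729/4 * e n x - 27/2 * e (n+1) x) \<and>
    (poly (A1 (4/3) (2/3) (1) (3/2) (n+2)) x = 729/16 * e n x + 27/2 * e (n+1) x + e (n+2) x \<and>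
     poly (A2 (4/3) (2/3) (1) (3/2) (n+2)) x = - 729/8 * e n x + 27/4 * e (n+1) x) \<and>
    (poly (A1 (4/3) (5/3) (3/2) (2) (n+2)) x = - 729/8 * e n x + 54 * e (n+1) x + e (n+2) x \<and>
     poly (A2 (4/3) (5/3) (3/2) (2) (n+2)) x = - 135/4 * e (n+1) x) \<and>
    (poly (A1 (5/3) (4/3) (3/2) (2) (n+2)) x = - 729/8 * e n x - 27/4 * e (n+1) x + e (n+2) x \<and>
     poly (A2 (5/3) (4/3) (3/2) (2) (n+2)) x = 27 * e (n+1) x) \<and>
    (poly (A1 (1/3) (2/3) (1) (3/2) (n+2)) x = - 729/8 * e n x - 27/4 * e (n+1) x + e (n+2) x \<and>
     poly (A2 (1/3) (2/3) (1) (3/2) (n+2)) x = 729/4 * e n x + 27 * e (n+1) x) \<and>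
    (poly (A1 (2/3) (1/3) (1) (3/2) (n+2)) x = 729/16 * e n x + 27/2 * e (n+1) x + e (n+2) x \<and>
     poly (A2 (2/3) (1/3) (1) (3/2) (n+2)) x = 729/16 * e n x + 27/4 * e (n+1) x) \<and>
    (poly (A1 (2/3) (4/3) (3/2) (2) (n+2)) x = 729/16 * e n x - 189/4 * e (n+1) x + e (n+2) x \<and>
     poly (A2 (2/3) (4/3) (3/2) (2) (n+2)) x = 135/2 * e (n+1) x) \<and>
    (poly (A1 (4/3) (2/3) (3/2) (2) (n+2)) x = 729/16 * e n x + 27/2 * e (n+1) x + e (n+2) x \<and>
     poly (A2 (4/3) (2/3) (3/2) (2) (n+2)) x = 27/4 * e (n+1) x) \<and>
    (poly (A1 (4/3) (5/3) (2) (5/2) (n+2)) x = - 27/2 * e (n+1) x + e (n+2) x \<and>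
     poly (A2 (4/3) (5/3) (2) (5/2) (n+2)) x = 135/4 * e (n+1) x) \<and>
    (poly (A1 (5/3) (4/3) (2) (5/2) (n+2)) x = 27/4 * e (n+1) x + e (n+2) x \<and>
     poly (A2 (5/3) (4/3) (2) (5/2) (n+2)) x = 27/2 * e (n+1) x)"
  by (simp_all only: formula_1.poly_A1 formula_1.poly_A2 formula_2.poly_A1 formula_2.poly_A2
    formula_3.poly_A1 formula_3.poly_A2 formula_4.poly_A1 formula_4.poly_A2
    formula_5.poly_A1 formula_5.poly_A2 formula_6.poly_A1 formula_6.poly_A2
    formula_7.poly_A1 formula_7.poly_A2 formula_8.poly_A1 formula_8.poly_A2
    formula_9.poly_A1 formula_9.poly_A2 formula_10.poly_A1 formula_10.poly_A2
    formula_11.poly_A1 formula_11.poly_A2 formula_12.poly_A1 formula_12.poly_A2)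
    (simp_all add: algebra_simps)

end
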